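(* Let $P$ be a nonempty finite poset, $d'(P)=\max\{d(P|_A)\mid A \text{ a proper subset of the ground set}\}$ and $\varepsilon(P)=d'(P)/d(P)$. Then $\varepsilon(P)\le 1-1/d(P)$, and for all integers $m\ge (m(P)+1)\,d(P)\ln 2$, $$1\le\frac{e(m+1,P)}{d(P)\,e(m,P)}\le 1+2^{m(P)}\varepsilon(P)^m;$$ thus $\frac{e(m+1,P)}{d(P)e(m,P)}=1+O(\varepsilon(P)^m)$, and $e(m+1,P)$ is asymptotically equal to $d(P)\,e(m,P)$ as $m\to\infty$.
   Context: $d(\cdot)$ is the number of downsets of a finite poset, $P|_A$ the induced subposet, $m(P)$ the number of minimal elements of $P$. For a finite poset $P$ on $K$ and a finite set $M$ disjoint from $K$ with $|M|=m$, $e(m,P)$ is the number of partial orders on $M\cup K$ inducing $P$ on $K$ whose set of minimal elements is exactly $M$. *)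

theory Defs
  imports "HOL-Real_Asymp.Real_Asymp"
begin

text \<open>A finite poset is given by a finite ground set \<open>K\<close> and its order relation \<open>r\<close> with
  \<open>partial_order_on K r\<close>; \<open>(x, y) \<in> r\<close> means \<open>x \<le> y\<close>. The induced subposet on
  \<open>A \<subseteq> K\<close> is \<open>(A, Restr r A)\<close>.\<close>

definition downsets :: "'a set \<Rightarrow> 'a rel \<Rightarrow> 'a set set" where
  "downsets K r = {D. D \<subseteq> K \<and> (\<forall>y\<in>D. \<forall>x\<in>K. (x, y) \<in> r \<longrightarrow> x \<in> D)}"

definition num_downsets :: "'a set \<Rightarrow> 'a rel \<Rightarrow> nat" where
  "num_downsets K r = card (downsets K r)"

definition minimal_elements :: "'a set \<Rightarrow> 'a rel \<Rightarrow> 'a set" where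
  "minimal_elements K r = {x \<in> K. \<forall>y\<in>K. (y, x) \<in> r \<longrightarrow> y = x}"

definition num_minimal :: "'a set \<Rightarrow> 'a rel \<Rightarrow> nat" where
  "num_minimal K r = card (minimal_elements K r)"

definition max_proper_downsets :: "'a set \<Rightarrow> 'a rel \<Rightarrow> nat" where
  "max_proper_downsets K r = Max {num_downsets A (Restr r A) | A. A \<subset> K}"

definition downset_ratio :: "'a set \<Rightarrow> 'a rel \<Rightarrow> real" where
  "downset_ratio K r = real (max_proper_downsets K r) / real (num_downsets K r)"

definition min_extensions :: "'a set \<Rightarrow> 'a set \<Rightarrow> 'a rel \<Rightarrow> 'a rel set" where
  "min_extensions M K r =
    {s. partial_order_on (M \<union> K) s \<and> Restr s K = r \<and> minimal_elements (M \<union> K) s = M}"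

text \<open>The type of \<open>K\<close> need not contain \<open>m\<close> elements outside \<open>K\<close>, so the number \<open>e(m, P)\<close>
  is taken in a sum type, where \<open>Inl ` {..<m}\<close> is a set of size \<open>m\<close> disjoint from the copy
  \<open>Inr ` K\<close> of \<open>K\<close>. By \<open>num_min_extensions_eq\<close> below, any other choice of \<open>M\<close>
  gives the same number.\<close>

definition num_min_extensions :: "nat \<Rightarrow> 'a set \<Rightarrow> 'a rel \<Rightarrow> nat" where
  "num_min_extensions m K r =
    card (min_extensions (Inl ` {..<m} :: (nat + 'a) set) (Inr ` K) (map_prod Inr Inr ` r))"

lemma finite_min_extensions:
  assumes "finite M" "finite K"
  shows "finite (min_extensions M K r)"
proof (rule finite_subset)
  show "min_extensions M K r \<subseteq> Pow ((M \<union> K) \<times> (M \<union> K))"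
    by (auto simp: min_extensions_def dest!: partial_order_onD(4))
qed (use assms in simp)

lemma map_prod_min_extensions:
  assumes inj: "inj_on f (M \<union> K)" and s: "s \<in> min_extensions M K r"
  shows "map_prod f f ` s \<in> min_extensions (f ` M) (f ` K) (map_prod f f ` r)"
proof -
  have po: "partial_order_on (M \<union> K) s" and res: "Restr s K = r"
    and mins: "minimal_elements (M \<union> K) s = M"
    using s by (auto simp: min_extensions_def)
  have sub: "s \<subseteq> (M \<union> K) \<times> (M \<union> K)" and refl: "refl_on (M \<union> K) s"
    and tr: "trans s" and anti: "antisym s"
    using partial_order_onD[OF po] by auto
  have iff: "(f x, f y) \<in> map_prod f f ` s \<longleftrightarrow> (x, y) \<in> s"
    if "x \<in> M \<union> K" "y \<in> M \<union> K" for x y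
  proof
    assume "(f x, f y) \<in> map_prod f f ` s"
    then obtain a b where ab: "(a, b) \<in> s" "f x = f a" "f y = f b" by auto
    with sub have "a \<in> M \<union> K" "b \<in> M \<union> K" by auto
    with ab that inj show "(x, y) \<in> s" by (metis inj_onD)
  qed force
  have elim: "\<exists>x\<in>M \<union> K. \<exists>y\<in>M \<union> K. u = f x \<and> v = f y \<and> (x, y) \<in> s"
    if "(u, v) \<in> map_prod f f ` s" for u v
    using that sub by auto
  have "partial_order_on (f ` (M \<union> K)) (map_prod f f ` s)"
    unfolding partial_order_on_def preorder_on_def
  proof (intro conjI)
    show "map_prod f f ` s \<subseteq> f ` (M \<union> K) \<times> f ` (M \<union> K)" using sub by auto
    show "refl_on (f ` (M \<union> K)) (map_prod f f ` s)"
      using refl iff by (auto simp: refl_on_def)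
    show "trans (map_prod f f ` s)"
    proof (rule transI)
      fix u v w
      assume uv: "(u, v) \<in> map_prod f f ` s" and vw: "(v, w) \<in> map_prod f f ` s"
      obtain x y where xy: "x \<in> M \<union> K" "y \<in> M \<union> K" "u = f x" "v = f y" "(x, y) \<in> s"
        using elim[OF uv] by blast
      obtain y' z where yz: "y' \<in> M \<union> K" "z \<in> M \<union> K" "v = f y'" "w = f z" "(y', z) \<in> s"
        using elim[OF vw] by blast
      have "y' = y" using inj xy yz by (metis inj_onD)
      with xy yz tr have "(x, z) \<in> s" by (blast dest: transD)
      with xy yz iff show "(u, w) \<in> map_prod f f ` s" by simp
    qed
    show "antisym (map_prod f f ` s)"
    proof (rule antisymI)
      fix u v
      assume uv: "(u, v) \<in> map_prod f f ` s" and vu: "(v, u) \<in> map_prod f f ` s"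
      obtain x y where xy: "x \<in> M \<union> K" "y \<in> M \<union> K" "u = f x" "v = f y" "(x, y) \<in> s"
        using elim[OF uv] by blast
      with vu iff anti show "u = v" by (auto dest: antisymD)
    qed
  qed
  moreover have "Restr (map_prod f f ` s) (f ` K) = map_prod f f ` r"
  proof (intro equalityI subsetI)
    fix p assume p: "p \<in> Restr (map_prod f f ` s) (f ` K)"
    then obtain x y where "x \<in> K" "y \<in> K" "p = (f x, f y)" by auto
    with p iff have "(x, y) \<in> r" by (auto simp flip: res)
    with \<open>p = (f x, f y)\<close> show "p \<in> map_prod f f ` r" by force
  next
    fix p assume "p \<in> map_prod f f ` r"
    then show "p \<in> Restr (map_prod f f ` s) (f ` K)" by (auto simp flip: res)
  qed
  moreover have "minimal_elements (f ` (M \<union> K)) (map_prod f f ` s) = f ` M"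
  proof -
    have "f x \<in> minimal_elements (f ` (M \<union> K)) (map_prod f f ` s)
      \<longleftrightarrow> x \<in> minimal_elements (M \<union> K) s" if x: "x \<in> M \<union> K" for x
    proof -
      have "((f y, f x) \<in> map_prod f f ` s \<longrightarrow> f y = f x) \<longleftrightarrow> ((y, x) \<in> s \<longrightarrow> y = x)"
        if "y \<in> M \<union> K" for y
        using iff[OF that x] inj_on_eq_iff[OF inj that x] by simp
      with x show ?thesis by (auto simp: minimal_elements_def)
    qed
    moreover have "minimal_elements (f ` (M \<union> K)) (map_prod f f ` s) \<subseteq> f ` (M \<union> K)"
      by (auto simp: minimal_elements_def)
    ultimately show ?thesis using mins by blast
  qed
  ultimately show ?thesis by (simp add: min_extensions_def image_Un)
qed

lemma card_min_extensions_le: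
  assumes inj: "inj_on f (M \<union> K)" and fin: "finite M" "finite K"
  shows "card (min_extensions M K r)
    \<le> card (min_extensions (f ` M) (f ` K) (map_prod f f ` r))"
proof (rule card_inj_on_le)
  show "inj_on (image (map_prod f f)) (min_extensions M K r)"
  proof (rule inj_on_subset)
    show "inj_on (image (map_prod f f)) (Pow ((M \<union> K) \<times> (M \<union> K)))"
      by (intro inj_on_image_Pow map_prod_inj_on inj)
    show "min_extensions M K r \<subseteq> Pow ((M \<union> K) \<times> (M \<union> K))"
      by (auto simp: min_extensions_def dest!: partial_order_onD(4))
  qed
  show "image (map_prod f f) ` min_extensions M K r
    \<subseteq> min_extensions (f ` M) (f ` K) (map_prod f f ` r)"
    using map_prod_min_extensions[OF inj] by blast
qed (intro finite_min_extensions finite_imageI fin)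

lemma num_min_extensions_eq:
  fixes M K :: "'a set"
  assumes M: "finite M" "card M = m" "M \<inter> K = {}"
    and K: "finite K" "partial_order_on K r"
  shows "num_min_extensions m K r = card (min_extensions M K r)"
proof -
  obtain h where h: "bij_betw h {..<m} M"
    using M ex_bij_betw_nat_finite[of M] by (auto simp: atLeast0LessThan)
  define f where "f = case_sum h (id :: 'a \<Rightarrow> 'a)"
  define g where "g = inv_into (Inl ` {..<m} \<union> Inr ` K) f"
  have inj: "inj_on f (Inl ` {..<m} \<union> Inr ` K)"
  proof -
    have "h i \<notin> K" if "i < m" for i
      using h M(3) bij_betwE that by fastforce
    with h show ?thesis by (auto simp: inj_on_def f_def bij_betw_def)
  qed
  have fM: "f ` Inl ` {..<m} = M" and fK: "f ` Inr ` K = K"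
    using h by (auto simp: f_def image_image bij_betw_def)
  have r: "r \<subseteq> K \<times> K" using K by (auto dest: partial_order_onD)
  have fr: "map_prod f f ` map_prod Inr Inr ` r = r"
    by (simp add: image_image f_def map_prod_def case_prod_unfold)
  have gf: "g (f x) = x" if "x \<in> Inl ` {..<m} \<union> Inr ` K" for x
    unfolding g_def using inj that by (rule inv_into_f_f)
  have gM: "g ` M = Inl ` {..<m}"
    unfolding fM[symmetric] image_image[of g f] using gf by force
  have gInr: "g x = Inr x" if "x \<in> K" for x
    using gf[of "Inr x"] that by (simp add: f_def)
  have gK: "g ` K = Inr ` K" using gInr by auto
  have gr: "map_prod g g ` r = map_prod Inr Inr ` r"
    by (rule image_cong) (use r gInr in auto)
  have "inj_on g (M \<union> K)"
    unfolding g_def using fM fK by (metis image_Un inj_on_inv_into order_refl)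
  from card_min_extensions_le[OF this M(1) K(1), of r]
  have "card (min_extensions M K r) \<le> num_min_extensions m K r"
    by (simp add: gM gK gr num_min_extensions_def)
  moreover have "num_min_extensions m K r \<le> card (min_extensions M K r)"
    using card_min_extensions_le[OF inj, of "map_prod Inr Inr ` r"] K
    by (simp add: fM fK fr num_min_extensions_def)
  ultimately show ?thesis by simp
qed

end

theory Submission
  imports Defs "HOL-Library.FuncSet"
begin

text \<open>An extension \<open>s\<close> of \<open>P\<close> by a set \<open>M\<close> of new minimal elements is determined by the downsets
  \<open>{k \<in> K. (x, k) \<notin> s}\<close> for \<open>x \<in> M\<close>; the only constraint is that no minimal element of \<open>P\<close>
  lies in all of them. So \<open>e(m, P)\<close> counts the \<open>m\<close>-tuples of downsets that avoid every minimal
  element at least once. Appending an arbitrary downset gives \<open>d(P) e(m, P) \<le> e(m + 1, P)\<close>.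
  For the converse, the \<open>m\<close>-tuples that all contain a fixed \<open>k\<close> number at most \<open>d'(P)^m\<close>,
  and a union bound over the minimal elements \<open>k\<close> bounds both the excess of \<open>e(m + 1, P)\<close>
  and the deficit \<open>d(P)^m - e(m, P)\<close>.\<close>

section \<open>Downsets of proper induced subposets\<close>

lemma finite_downsets [simp]: "finite K \<Longrightarrow> finite (downsets K r)"
  by (rule finite_subset[of _ "Pow K"]) (auto simp: downsets_def)

lemma empty_in_downsets [simp]: "{} \<in> downsets K r"
  by (simp add: downsets_def)

lemma num_downsets_pos: "finite K \<Longrightarrow> num_downsets K r > 0"
  unfolding num_downsets_def by (metis card_gt_0_iff empty_in_downsets equals0D finite_downsets)

text \<open>Intersecting with \<open>A\<close> maps the downsets of \<open>K\<close> onto those of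
  \<open>A\<close>, but not injectively.\<close>

lemma num_downsets_proper_less:
  assumes K: "finite K" "partial_order_on K r" and A: "A \<subset> K"
  shows "num_downsets A (Restr r A) < num_downsets K r"
proof -
  have refl: "\<And>x. x \<in> K \<Longrightarrow> (x, x) \<in> r" and tr: "trans r" and anti: "antisym r"
    and sub: "r \<subseteq> K \<times> K"
    using partial_order_onD[OF K(2)] by (auto simp: refl_on_def)
  have img: "downsets A (Restr r A) \<subseteq> (\<lambda>D. D \<inter> A) ` downsets K r"
  proof
    fix D assume D: "D \<in> downsets A (Restr r A)"
    \<comment> \<open>The down-closure of \<open>D\<close> in \<open>K\<close> is a preimage of
      \<open>D\<close>: it adds no element of \<open>A\<close>, since \<open>D\<close> is already a
      downset there.\<close>
    let ?E = "{x \<in> K. \<exists>y\<in>D. (x, y) \<in> r}"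
    have "?E \<in> downsets K r" using tr by (auto simp: downsets_def dest: transD)
    moreover have "?E \<inter> A = D" using D A refl by (auto simp: downsets_def)
    ultimately show "D \<in> (\<lambda>D. D \<inter> A) ` downsets K r" by blast
  qed
  obtain x where x: "x \<in> K" "x \<notin> A" using A by blast
  \<comment> \<open>The principal downset of \<open>x\<close> remains a downset when its top
    \<open>x\<close> is removed. As \<open>x\<close> lies outside \<open>A\<close>, both have the
    same trace on \<open>A\<close>.\<close>
  let ?D = "{y. (y, x) \<in> r}"
  have D: "?D \<in> downsets K r" using sub tr by (auto simp: downsets_def dest: transD)
  have D': "?D - {x} \<in> downsets K r"
    using sub tr anti by (auto simp: downsets_def dest: transD antisymD)
  have "\<not> inj_on (\<lambda>D. D \<inter> A) (downsets K r)"
  proof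
    assume "inj_on (\<lambda>D. D \<inter> A) (downsets K r)"
    from inj_onD[OF this _ D D'] x refl show False by auto
  qed
  with K have "card ((\<lambda>D. D \<inter> A) ` downsets K r) < card (downsets K r)"
    by (metis card_image_le eq_card_imp_inj_on finite_downsets le_neq_implies_less)
  moreover have "card (downsets A (Restr r A)) \<le> card ((\<lambda>D. D \<inter> A) ` downsets K r)"
    using img K by (intro card_mono) auto
  ultimately show ?thesis unfolding num_downsets_def by linarith
qed

lemma finite_proper_num_downsets:
  "finite K \<Longrightarrow> finite {num_downsets A (Restr r A) | A. A \<subset> K}"
  by (rule finite_subset[of _ "(\<lambda>A. num_downsets A (Restr r A)) ` Pow K"]) auto

lemma max_proper_downsets_less:
  assumes "finite K" "K \<noteq> {}" "partial_order_on K r"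
  shows "max_proper_downsets K r < num_downsets K r"
proof -
  \<comment> \<open>The empty set is a proper subset of \<open>K\<close>, so \<open>Max\<close> is
    taken over a nonempty set.\<close>
  have "{num_downsets A (Restr r A) | A. A \<subset> K} \<noteq> {}" using assms(2) by blast
  with finite_proper_num_downsets[OF assms(1)] show ?thesis
    unfolding max_proper_downsets_def
    using num_downsets_proper_less[OF assms(1,3)] by (subst Max_less_iff) auto
qed

text \<open>Deleting \<open>k\<close> from sets known to contain it is injective, and it leaves
  downsets of the proper subposet on \<open>K - {k}\<close>.\<close>

lemma card_downsets_containing_le:
  assumes K: "finite K" and k: "k \<in> K"
  shows "card {D \<in> downsets K r. k \<in> D} \<le> max_proper_downsets K r"
proof -
  let ?A = "K - {k}"
  have "card {D \<in> downsets K r. k \<in> D} \<le> card (downsets ?A (Restr r ?A))"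
  proof (rule card_inj_on_le)
    show "inj_on (\<lambda>D. D - {k}) {D \<in> downsets K r. k \<in> D}"
      by (rule inj_onI) blast
    show "(\<lambda>D. D - {k}) ` {D \<in> downsets K r. k \<in> D} \<subseteq> downsets ?A (Restr r ?A)"
      by (auto simp: downsets_def)
  qed (use K in simp)
  also have "\<dots> \<le> max_proper_downsets K r"
    unfolding max_proper_downsets_def num_downsets_def[symmetric]
    using k by (intro Max_ge finite_proper_num_downsets K) blast
  finally show ?thesis .
qed

section \<open>Extensions as tuples of downsets\<close>

definition avoiding_tuples :: "nat \<Rightarrow> 'a set \<Rightarrow> 'a rel \<Rightarrow> (nat \<Rightarrow> 'a set) set" where
  "avoiding_tuples m K r =
    {f \<in> {..<m} \<rightarrow>\<^sub>E downsets K r. \<forall>k\<in>minimal_elements K r. \<exists>i<m. k \<notin> f i}"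

text \<open>The elements of \<open>K\<close> above a new minimal element form an upset; its
  complement is recorded. The restricted lambda is \<open>undefined\<close> off
  \<open>{..<m}\<close>, as \<open>PiE\<close> demands, which makes the tuple unique.\<close>

definition tuple_of_ext :: "nat \<Rightarrow> 'a set \<Rightarrow> (nat + 'a) rel \<Rightarrow> nat \<Rightarrow> 'a set" where
  "tuple_of_ext m K s = (\<lambda>i\<in>{..<m}. {k \<in> K. (Inl i, Inr k) \<notin> s})"

definition ext_of_tuple :: "nat \<Rightarrow> 'a set \<Rightarrow> 'a rel \<Rightarrow> (nat \<Rightarrow> 'a set) \<Rightarrow> (nat + 'a) rel" where
  "ext_of_tuple m K r f = {(Inl i, Inl i) | i. i < m} \<union> map_prod Inr Inr ` r
     \<union> {(Inl i, Inr k) | i k. i < m \<and> k \<in> K \<and> k \<notin> f i}"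

lemma ext_of_tuple_iff [simp]:
  "(Inl i, Inl j) \<in> ext_of_tuple m K r f \<longleftrightarrow> i = j \<and> i < m"
  "(Inr a, Inr b) \<in> ext_of_tuple m K r f \<longleftrightarrow> (a, b) \<in> r"
  "(Inl i, Inr b) \<in> ext_of_tuple m K r f \<longleftrightarrow> i < m \<and> b \<in> K \<and> b \<notin> f i"
  "(Inr a, Inl j) \<notin> ext_of_tuple m K r f"
  by (auto simp: ext_of_tuple_def)

text \<open>Transitivity of \<open>s\<close> makes each entry a downset. A minimal element of
  \<open>P\<close> is not minimal for \<open>s\<close>; what lies strictly below it cannot come from
  \<open>K\<close>, so it is a new element. The pairs that the tuple does not record are forced:
  \<open>r\<close> fixes those inside \<open>K\<close>, and nothing but itself lies below a new
  element.\<close>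

lemma tuple_of_ext_in:
  assumes K: "finite K" "partial_order_on K r"
    and s: "s \<in> min_extensions (Inl ` {..<m}) (Inr ` K) (map_prod Inr Inr ` r)"
  shows "tuple_of_ext m K s \<in> avoiding_tuples m K r"
    and "ext_of_tuple m K r (tuple_of_ext m K s) = s"
proof -
  let ?G = "Inl ` {..<m} \<union> Inr ` K"
  have po: "partial_order_on ?G s" and res: "Restr s (Inr ` K) = map_prod Inr Inr ` r"
    and mins: "minimal_elements ?G s = Inl ` {..<m}"
    using s by (auto simp: min_extensions_def)
  have refl: "\<And>x. x \<in> ?G \<Longrightarrow> (x, x) \<in> s" and tr: "trans s" and sub: "s \<subseteq> ?G \<times> ?G"
    using partial_order_onD[OF po] by (auto simp: refl_on_def)
  have rsub: "r \<subseteq> K \<times> K" using partial_order_onD[OF K(2)] by auto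
  have r_iff: "(Inr a, Inr b) \<in> s \<longleftrightarrow> (a, b) \<in> r" for a b
  proof -
    have "(Inr a, Inr b) \<in> s \<longleftrightarrow> (Inr a, Inr b) \<in> Restr s (Inr ` K)" using sub by auto
    also have "\<dots> \<longleftrightarrow> (a, b) \<in> r" unfolding res by auto
    finally show ?thesis .
  qed
  have bot: "x = Inl i" if "(x, Inl i) \<in> s" for x i
  proof -
    have "x \<in> ?G" "Inl i \<in> minimal_elements ?G s" unfolding mins using that sub by auto
    with that show ?thesis unfolding minimal_elements_def by blast
  qed
  have "\<exists>i<m. (Inl i, Inr k) \<in> s" if k: "k \<in> minimal_elements K r" for k
  proof -
    have "k \<in> K" using k by (simp add: minimal_elements_def)
    have "Inr k \<notin> minimal_elements ?G s" unfolding mins by auto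
    then obtain y where y: "y \<in> ?G" "(y, Inr k) \<in> s" "y \<noteq> Inr k"
      using \<open>k \<in> K\<close> by (auto simp: minimal_elements_def)
    with k r_iff show ?thesis by (auto simp: minimal_elements_def)
  qed
  moreover have "{k \<in> K. (Inl i, Inr k) \<notin> s} \<in> downsets K r" for i
    using tr r_iff by (auto simp: downsets_def dest: transD)
  ultimately show "tuple_of_ext m K s \<in> avoiding_tuples m K r"
    by (fastforce simp: avoiding_tuples_def tuple_of_ext_def)
  show "ext_of_tuple m K r (tuple_of_ext m K s) = s"
  proof (rule set_eqI)
    fix p :: "(nat + 'a) \<times> (nat + 'a)"
    obtain x y where p: "p = (x, y)" by fastforce
    show "p \<in> ext_of_tuple m K r (tuple_of_ext m K s) \<longleftrightarrow> p \<in> s"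
      using sub r_iff refl unfolding p
      by (cases x; cases y) (auto simp: tuple_of_ext_def dest: bot)
  qed
qed

lemma ext_of_tuple_in:
  assumes K: "finite K" "partial_order_on K r" and f: "f \<in> avoiding_tuples m K r"
  shows "ext_of_tuple m K r f \<in> min_extensions (Inl ` {..<m}) (Inr ` K) (map_prod Inr Inr ` r)"
    and "tuple_of_ext m K (ext_of_tuple m K r f) = f"
proof -
  let ?G = "Inl ` {..<m} \<union> Inr ` K" and ?s = "ext_of_tuple m K r f"
  have refl: "\<And>x. x \<in> K \<Longrightarrow> (x, x) \<in> r" and tr: "trans r" and anti: "antisym r"
    and sub: "r \<subseteq> K \<times> K"
    using partial_order_onD[OF K(2)] by (auto simp: refl_on_def)
  have fE: "f \<in> {..<m} \<rightarrow>\<^sub>E downsets K r"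
    and cov: "\<And>k. k \<in> minimal_elements K r \<Longrightarrow> \<exists>i<m. k \<notin> f i"
    using f by (auto simp: avoiding_tuples_def)
  have down: "a \<in> f i" if "i < m" "b \<in> f i" "(a, b) \<in> r" for a b i
    using fE that sub by (auto simp: PiE_iff downsets_def)
  have fsub: "f i \<subseteq> K" if "i < m" for i
    using fE that by (auto simp: PiE_iff downsets_def)
  have "partial_order_on ?G ?s"
    unfolding partial_order_on_def preorder_on_def
  proof (intro conjI)
    show "?s \<subseteq> ?G \<times> ?G" using sub by (auto simp: ext_of_tuple_def)
    show "refl_on ?G ?s" using refl by (auto simp: refl_on_def)
    show "trans ?s"
    proof (rule transI)
      \<comment> \<open>The case with content is a new element followed by two elements of
        \<open>K\<close>: the complement of a downset is closed upwards.\<close>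
      fix x y z assume "(x, y) \<in> ?s" "(y, z) \<in> ?s"
      then show "(x, z) \<in> ?s"
        using sub by (cases x; cases y; cases z) (auto intro: transD[OF tr] dest: down)
    qed
    show "antisym ?s"
    proof (rule antisymI)
      fix x y assume "(x, y) \<in> ?s" "(y, x) \<in> ?s"
      then show "x = y" using anti by (cases x; cases y) (auto dest: antisymD)
    qed
  qed
  moreover have "Restr ?s (Inr ` K) = map_prod Inr Inr ` r"
    using sub by (auto simp: ext_of_tuple_def)
  moreover have "minimal_elements ?G ?s = Inl ` {..<m}"
  proof (intro equalityI subsetI)
    fix x assume x: "x \<in> minimal_elements ?G ?s"
    show "x \<in> Inl ` {..<m}"
    proof (rule ccontr)
      assume "x \<notin> Inl ` {..<m}"
      with x obtain k where k: "x = Inr k" "k \<in> K" by (auto simp: minimal_elements_def)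
      \<comment> \<open>Minimality in the whole extension passes to the induced order on
        \<open>K\<close>. Avoidance then places a new element below \<open>k\<close>, a
        contradiction.\<close>
      have "k \<in> minimal_elements K r" using x k
        by (simp add: minimal_elements_def ball_Un)
      then obtain i where "i < m" "k \<notin> f i" using cov by blast
      with x k show False by (auto simp: minimal_elements_def ball_Un)
    qed
  qed (auto simp: minimal_elements_def)
  ultimately show "?s \<in> min_extensions (Inl ` {..<m}) (Inr ` K) (map_prod Inr Inr ` r)"
    by (simp add: min_extensions_def)
  show "tuple_of_ext m K ?s = f"
  proof
    fix i show "tuple_of_ext m K ?s i = f i"
      using fE fsub by (cases "i < m") (auto simp: tuple_of_ext_def PiE_iff extensional_def)
  qed
qed

lemma num_min_extensions_eq_avoiding_tuples:
  assumes "finite K" "partial_order_on K r"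
  shows "num_min_extensions m K r = card (avoiding_tuples m K r)"
  unfolding num_min_extensions_def
  by (rule bij_betw_same_card[where f = "tuple_of_ext m K"],
      rule bij_betw_byWitness[where f' = "ext_of_tuple m K r"])
    (use tuple_of_ext_in[OF assms] ext_of_tuple_in[OF assms] in blast)+

section \<open>Counting avoiding tuples\<close>

lemma finite_avoiding_tuples [simp]: "finite K \<Longrightarrow> finite (avoiding_tuples m K r)"
  by (rule finite_subset[of _ "{..<m} \<rightarrow>\<^sub>E downsets K r"])
    (auto simp: avoiding_tuples_def intro!: finite_PiE)

text \<open>The union consists of exactly those tuples of downsets that fail to be avoiding, since
  all their entries share some minimal element.\<close>

lemma card_containing_tuples_le:
  assumes K: "finite K"
  shows "card (\<Union>k\<in>minimal_elements K r. {..<m} \<rightarrow>\<^sub>E {D \<in> downsets K r. k \<in> D})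
    \<le> num_minimal K r * max_proper_downsets K r ^ m"
proof -
  have fin: "finite (minimal_elements K r)" using K by (simp add: minimal_elements_def)
  have "card (\<Union>k\<in>minimal_elements K r. {..<m} \<rightarrow>\<^sub>E {D \<in> downsets K r. k \<in> D})
    \<le> (\<Sum>k\<in>minimal_elements K r. card ({..<m} \<rightarrow>\<^sub>E {D \<in> downsets K r. k \<in> D}))"
    by (rule card_UN_le[OF fin])
  also have "\<dots> \<le> (\<Sum>k\<in>minimal_elements K r. max_proper_downsets K r ^ m)"
    by (intro sum_mono)
      (auto simp: card_PiE minimal_elements_def
        intro!: power_mono card_downsets_containing_le K)
  finally show ?thesis by (simp add: num_minimal_def)
qed

lemma tuples_subset:
  "{..<m} \<rightarrow>\<^sub>E downsets K r \<subseteq> avoiding_tuples m K r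
     \<union> (\<Union>k\<in>minimal_elements K r. {..<m} \<rightarrow>\<^sub>E {D \<in> downsets K r. k \<in> D})"
  unfolding avoiding_tuples_def by (fastforce simp: PiE_iff)

lemma finite_containing_tuples:
  fixes m :: nat
  shows "finite K \<Longrightarrow>
    finite (\<Union>k\<in>minimal_elements K r. {..<m} \<rightarrow>\<^sub>E {D \<in> downsets K r. k \<in> D})"
  by (intro finite_UN_I finite_PiE) (simp_all add: minimal_elements_def)

lemma card_avoiding_tuples_lower:
  assumes K: "finite K"
  shows "num_downsets K r ^ m
    \<le> card (avoiding_tuples m K r) + num_minimal K r * max_proper_downsets K r ^ m"
proof -
  have "num_downsets K r ^ m = card ({..<m} \<rightarrow>\<^sub>E downsets K r)"
    by (simp add: card_PiE num_downsets_def)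
  also have "\<dots> \<le> card (avoiding_tuples m K r
     \<union> (\<Union>k\<in>minimal_elements K r. {..<m} \<rightarrow>\<^sub>E {D \<in> downsets K r. k \<in> D}))"
    by (intro card_mono tuples_subset finite_UnI finite_avoiding_tuples finite_containing_tuples K)
  also have "\<dots> \<le> card (avoiding_tuples m K r) + num_minimal K r * max_proper_downsets K r ^ m"
    by (rule order_trans[OF card_Un_le]) (intro add_left_mono card_containing_tuples_le K)
  finally show ?thesis .
qed

text \<open>An entry appended at index \<open>m\<close> leaves intact the avoidance already
  witnessed among the first \<open>m\<close> entries.\<close>

lemma card_avoiding_tuples_Suc_ge:
  assumes K: "finite K"
  shows "num_downsets K r * card (avoiding_tuples m K r) \<le> card (avoiding_tuples (Suc m) K r)"
proof -
  let ?g = "\<lambda>(D, f). f(m := D)"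
  have "inj_on ?g (downsets K r \<times> ({..<m} \<rightarrow>\<^sub>E downsets K r))"
    using inj_combinator[of m "{..<m}" "\<lambda>_. downsets K r"] by simp
  then have inj: "inj_on ?g (downsets K r \<times> avoiding_tuples m K r)"
    by (rule inj_on_subset) (auto simp: avoiding_tuples_def)
  have "?g ` (downsets K r \<times> avoiding_tuples m K r) \<subseteq> avoiding_tuples (Suc m) K r"
    by (fastforce simp: avoiding_tuples_def PiE_iff extensional_def less_Suc_eq)
  from card_inj_on_le[OF inj this] K show ?thesis
    by (simp add: card_cartesian_product num_downsets_def)
qed

text \<open>Avoidance of the longer tuple is given up entirely: its last entry is any downset, and
  its first \<open>m\<close> entries are avoiding or share a minimal element.\<close>

lemma card_avoiding_tuples_Suc_le:
  assumes K: "finite K"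
  shows "card (avoiding_tuples (Suc m) K r) \<le> num_downsets K r *
    (card (avoiding_tuples m K r) + num_minimal K r * max_proper_downsets K r ^ m)"
proof -
  let ?g = "\<lambda>(D, f). f(m := D)"
  let ?C = "\<Union>k\<in>minimal_elements K r. {..<m} \<rightarrow>\<^sub>E {D \<in> downsets K r. k \<in> D}"
  have "avoiding_tuples (Suc m) K r \<subseteq> {..<Suc m} \<rightarrow>\<^sub>E downsets K r"
    by (auto simp: avoiding_tuples_def)
  also have "\<dots> = ?g ` (downsets K r \<times> ({..<m} \<rightarrow>\<^sub>E downsets K r))"
    by (simp add: lessThan_Suc PiE_insert_eq)
  also have "\<dots> \<subseteq> ?g ` (downsets K r \<times> (avoiding_tuples m K r \<union> ?C))"
    by (intro image_mono Sigma_mono order_refl tuples_subset)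
  finally have "card (avoiding_tuples (Suc m) K r)
      \<le> card (downsets K r \<times> (avoiding_tuples m K r \<union> ?C))"
    by (rule surj_card_le[rotated])
      (intro finite_cartesian_product finite_UnI finite_downsets finite_avoiding_tuples
        finite_containing_tuples K)
  also have "\<dots> \<le> num_downsets K r *
      (card (avoiding_tuples m K r) + num_minimal K r * max_proper_downsets K r ^ m)"
    unfolding card_cartesian_product num_downsets_def
    by (intro mult_left_mono order_trans[OF card_Un_le] add_left_mono
        card_containing_tuples_le K) simp
  finally show ?thesis .
qed

section \<open>Ratio bounds and asymptotics\<close>

lemma downset_ratio_le:
  assumes "finite K" "K \<noteq> {}" "partial_order_on K r"
  shows "downset_ratio K r \<le> 1 - 1 / real (num_downsets K r)"
proof -
  have "real (max_proper_downsets K r) \<le> real (num_downsets K r) - 1"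
    using max_proper_downsets_less[OF assms] by linarith
  then show ?thesis
    using num_downsets_pos[OF assms(1), of r] by (simp add: downset_ratio_def field_simps)
qed

text \<open>With p = m(P), the ratio exceeds 1 by at most p d'(P)^m / e(m, P). The threshold on
  \<open>m\<close> makes at least half of all d(P)^m tuples avoiding, so the excess is at most 2 p
  times the \<open>m\<close>-th power of the downset ratio, and 2 p <= 2^p.\<close>

lemma num_min_extensions_ratio_bounds:
  assumes K: "finite K" "K \<noteq> {}" "partial_order_on K r"
    and m: "real m \<ge> (real (num_minimal K r) + 1) * real (num_downsets K r) * ln 2"
  shows "1 \<le> real (num_min_extensions (m + 1) K r)
      / (real (num_downsets K r) * real (num_min_extensions m K r))"
    and "real (num_min_extensions (m + 1) K r)
      / (real (num_downsets K r) * real (num_min_extensions m K r))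
      \<le> 1 + 2 ^ num_minimal K r * downset_ratio K r ^ m"
proof -
  define p d d' e e' \<epsilon> where defs: "p = num_minimal K r" "d = real (num_downsets K r)"
    "d' = real (max_proper_downsets K r)" "e = real (card (avoiding_tuples m K r))"
    "e' = real (card (avoiding_tuples (Suc m) K r))" "\<epsilon> = downset_ratio K r"
  have d: "d > 0" using num_downsets_pos[OF K(1), of r] by (simp add: defs)
  have \<epsilon>: "0 \<le> \<epsilon>" "\<epsilon> \<le> 1 - 1 / d" "d' = \<epsilon> * d"
    using downset_ratio_le[OF K(1-3)] d by (auto simp: defs downset_ratio_def)
  \<comment> \<open>The inequality 1 + x <= exp x at x = -1/d. The logarithm of 2 in the threshold
    on \<open>m\<close> then yields a power of 2.\<close>
  have "\<epsilon> \<le> exp (- (1 / d))" using \<epsilon>(2) exp_ge_add_one_self[of "- (1 / d)"] by linarith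
  then have "\<epsilon> ^ m \<le> exp (- (1 / d)) ^ m" using \<epsilon>(1) by (intro power_mono)
  also have "\<dots> = exp (- (real m / d))" by (simp add: exp_of_nat_mult[symmetric])
  also have "\<dots> \<le> exp (- (real (p + 1) * ln 2))"
    using m d by (simp add: defs field_simps)
  also have "\<dots> = 1 / 2 ^ (p + 1)"
    unfolding exp_minus using exp_of_nat_mult[of "p + 1" "ln 2 :: real"]
    by (simp only: exp_ln zero_less_numeral divide_inverse mult_1_left)
  finally have \<epsilon>m: "\<epsilon> ^ m \<le> 1 / 2 ^ (p + 1)" .
  \<comment> \<open>This form includes p = 0, and its factor 1/2 is absorbed later by
    \<open>e_ge\<close>.\<close>
  have p_le: "real p \<le> 2 ^ p / 2"
  proof (cases p)
    case (Suc q)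
    have "Suc q \<le> 2 ^ q" by (rule Suc_leI[OF less_exp])
    then have "real (Suc q) \<le> 2 ^ q" by (metis of_nat_le_iff of_nat_numeral of_nat_power)
    then show ?thesis by (simp add: Suc)
  qed simp
  \<comment> \<open>The right-hand side equals 1/4, within the bound 1/2 used below.\<close>
  have "real p * \<epsilon> ^ m \<le> 2 ^ p / 2 * (1 / 2 ^ (p + 1))"
    using p_le \<epsilon>m \<epsilon>(1) by (intro mult_mono) auto
  then have p\<epsilon>: "real p * \<epsilon> ^ m \<le> 1 / 2" by simp
  have "d ^ m \<le> e + real p * d' ^ m"
    using card_avoiding_tuples_lower[OF K(1), where r = r and m = m]
    unfolding defs by (simp flip: of_nat_power of_nat_mult of_nat_add)
  then have "d ^ m * (1 - real p * \<epsilon> ^ m) \<le> e"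
    by (simp add: \<epsilon>(3) power_mult_distrib algebra_simps)
  moreover have "d ^ m * (1 / 2) \<le> d ^ m * (1 - real p * \<epsilon> ^ m)"
    using p\<epsilon> d by (intro mult_left_mono) auto
  \<comment> \<open>This also gives e(m, P) > 0, so the quotients in the claim are not the default
    value 0 of division by zero.\<close>
  ultimately have e_ge: "d ^ m / 2 \<le> e" by simp
  moreover have "0 < d ^ m" using d by simp
  ultimately have e: "e > 0" by linarith
  have eq: "real (num_min_extensions m K r) = e" "real (num_min_extensions (m + 1) K r) = e'"
    by (simp_all add: defs num_min_extensions_eq_avoiding_tuples[OF K(1,3)])
  have lower: "d * e \<le> e'"
    using card_avoiding_tuples_Suc_ge[OF K(1), where r = r and m = m]
    unfolding defs by (simp flip: of_nat_mult)
  then show "1 \<le> real (num_min_extensions (m + 1) K r)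
      / (real (num_downsets K r) * real (num_min_extensions m K r))"
    unfolding eq defs(2)[symmetric] using d e by simp
  have "e' \<le> d * (e + real p * d' ^ m)"
    using card_avoiding_tuples_Suc_le[OF K(1), where r = r and m = m]
    unfolding defs by (simp flip: of_nat_power of_nat_mult of_nat_add)
  moreover have "real p * d' ^ m \<le> 2 ^ p * \<epsilon> ^ m * e"
  proof -
    have "real p * d' ^ m = real p * (\<epsilon> ^ m * d ^ m)" by (simp add: \<epsilon>(3) power_mult_distrib)
    also have "\<dots> \<le> 2 ^ p / 2 * (\<epsilon> ^ m * d ^ m)"
      using p_le \<epsilon>(1) d by (intro mult_right_mono) auto
    also have "\<dots> = 2 ^ p * \<epsilon> ^ m * (d ^ m / 2)" by simp
    also have "\<dots> \<le> 2 ^ p * \<epsilon> ^ m * e"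
      using e_ge \<epsilon>(1) by (intro mult_left_mono) auto
    finally show ?thesis .
  qed
  ultimately have "e' \<le> d * (e + 2 ^ p * \<epsilon> ^ m * e)"
    using d by (meson add_left_mono mult_left_mono less_imp_le order_trans)
  then show "real (num_min_extensions (m + 1) K r)
      / (real (num_downsets K r) * real (num_min_extensions m K r))
      \<le> 1 + 2 ^ num_minimal K r * downset_ratio K r ^ m"
    unfolding eq defs(1,2,6)[symmetric] using d e by (simp add: field_simps)
qed

theorem theorem6p3:
  fixes K :: "'a set" and r :: "'a rel"
  assumes "finite K" and "K \<noteq> {}" and "partial_order_on K r"
  shows "downset_ratio K r \<le> 1 - 1 / real (num_downsets K r) \<and>
         (\<forall>m::nat. real m \<ge> (real (num_minimal K r) + 1) * real (num_downsets K r) * ln 2 \<longrightarrow>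
           1 \<le> real (num_min_extensions (m + 1) K r)
                 / (real (num_downsets K r) * real (num_min_extensions m K r)) \<and>
           real (num_min_extensions (m + 1) K r)
                 / (real (num_downsets K r) * real (num_min_extensions m K r))
             \<le> 1 + 2 ^ num_minimal K r * downset_ratio K r ^ m) \<and>
         (\<lambda>m::nat. real (num_min_extensions (m + 1) K r)
             / (real (num_downsets K r) * real (num_min_extensions m K r)) - 1)
           \<in> O(\<lambda>m. downset_ratio K r ^ m) \<and>
         (\<lambda>m::nat. real (num_min_extensions (m + 1) K r))
           \<sim>[at_top] (\<lambda>m. real (num_downsets K r) * real (num_min_extensions m K r))"
proof -
  define \<epsilon> where "\<epsilon> = downset_ratio K r"
  define q where "q = (\<lambda>m::nat. real (num_min_extensions (m + 1) K r)
    / (real (num_downsets K r) * real (num_min_extensions m K r)))"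
  have d: "real (num_downsets K r) > 0" using num_downsets_pos[OF assms(1), of r] by simp
  \<comment> \<open>Strictness comes from 1/d(P) > 0 and is what makes the powers tend to 0.\<close>
  have \<epsilon>: "0 \<le> \<epsilon>" "\<epsilon> < 1"
    using downset_ratio_le[OF assms] d by (auto simp: \<epsilon>_def downset_ratio_def field_simps)
  have ev: "\<forall>\<^sub>F m::nat in at_top.
      real m \<ge> (real (num_minimal K r) + 1) * real (num_downsets K r) * ln 2"
    using filterlim_real_sequentially by (simp add: filterlim_at_top)
  note bounds = num_min_extensions_ratio_bounds[OF assms]
  have "\<forall>\<^sub>F m in at_top. norm (q m - 1) \<le> 2 ^ num_minimal K r * norm (\<epsilon> ^ m)"
    using ev
  proof eventually_elim
    case (elim m)
    \<comment> \<open>The lower bound 1 on the quotient removes the absolute value.\<close>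
    with bounds[OF elim] \<epsilon>(1) show ?case by (simp add: q_def \<epsilon>_def)
  qed
  then have bigo: "(\<lambda>m. q m - 1) \<in> O(\<lambda>m. \<epsilon> ^ m)" by (rule bigoI)
  have "(\<lambda>m. \<epsilon> ^ m) \<longlonglongrightarrow> 0" using \<epsilon> by (intro LIMSEQ_realpow_zero)
  \<comment> \<open>Strengthening the O-bound to o(1) turns it into convergence of the quotient to
    1, hence asymptotic equality.\<close>
  then have "(\<lambda>m. \<epsilon> ^ m) \<in> o(\<lambda>_. 1 :: real)" by (intro smalloI_tendsto) auto
  with bigo have "(\<lambda>m. q m - 1) \<in> o(\<lambda>_. 1 :: real)" by (rule landau_o.big_small_trans)
  then have "(\<lambda>m. q m - 1) \<longlonglongrightarrow> 0" by (auto dest: smalloD_tendsto)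
  then have "q \<longlonglongrightarrow> 1" by (simp add: LIM_zero_iff)
  then have "(\<lambda>m::nat. real (num_min_extensions (m + 1) K r))
      \<sim>[at_top] (\<lambda>m. real (num_downsets K r) * real (num_min_extensions m K r))"
    unfolding q_def by (rule asymp_equivI')
  then show ?thesis
    using downset_ratio_le[OF assms] bounds bigo unfolding q_def \<epsilon>_def by blast
qed

end
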